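(* Let $\Theta$ be an $r\times s$ matrix with real entries, and let $$\Gamma(\Theta)=\{(\boldsymbol{n},\Theta\boldsymbol{n})\mid\boldsymbol{n}\in\mathrm{Ker}(\varepsilon(\Theta))\cap\mathbb{Z}^{s}\}\subset\mathbb{Z}^{s+r}.$$ Then $$L(\Theta)=\widetilde{L}(\Theta)/\Gamma(\Theta)\cong\mathbb{R}^{s}/(\mathrm{Ker}(\varepsilon(\Theta))\cap\mathbb{Z}^{s}).$$ In particular, the Kronecker foliation $\mathfrak{F}(\Theta)$ has planar leaves if and only if the columns of $\Theta$ are inhomogeneously independent over $\mathbb{Q}$.
   Context: Fix a non-principal ultrafilter on $\mathbb{N}$; ${}^{\ast}\mathbb{Z}\subset{}^{\ast}\mathbb{R}$ are the ultrapowers and ${}^{\ast}\mathbb{R}_{\varepsilon}$ the infinitesimals. Let ${}^{\ast}\mathbb{Z}^{s}(\Theta)$ be the group of ${}^{\ast}\boldsymbol{n}\in{}^{\ast}\mathbb{Z}^{s}$ for which there is a (necessarily unique) ${}^{\ast}\boldsymbol{n}^{\perp}\in{}^{\ast}\mathbb{Z}^{r}$ with $\varepsilon(\Theta)({}^{\ast}\boldsymbol{n}):=\Theta\,{}^{\ast}\boldsymbol{n}-{}^{\ast}\boldsymbol{n}^{\perp}\in{}^{\ast}\mathbb{R}_{\varepsilon}^{r}$; this defines the homomorphism $\varepsilon(\Theta):{}^{\ast}\mathbb{Z}^{s}(\Theta)\to{}^{\ast}\mathbb{R}_{\varepsilon}^{r}$. $\widetilde{L}(\Theta)\subset\mathbb{R}^{s+r}$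 is the graph $\{(\boldsymbol{x},\Theta\boldsymbol{x})\}$ of $\Theta:\mathbb{R}^{s}\to\mathbb{R}^{r}$, $L(\Theta)$ is its image in $\mathbb{T}^{s+r}=\mathbb{R}^{s+r}/\mathbb{Z}^{s+r}$ (with the leaf topology, i.e. the quotient topology from $\widetilde{L}(\Theta)$), and the inhomogeneous Kronecker foliation $\mathfrak{F}(\Theta)=(\mathbb{T}^{s+r},L(\Theta))$ is the foliation of $\mathbb{T}^{s+r}$ by the cosets of $L(\Theta)$. Leaves are planar if they are homeomorphic to $\mathbb{R}^{s}$ in the leaf topology. The columns $\Theta^{(1)},\dots,\Theta^{(s)}$ are inhomogeneously independent over $\mathbb{Q}$ if $\Theta^{(1)},\dots,\Theta^{(s)},\boldsymbol{e}_{1},\dots,\boldsymbol{e}_{r}$ are linearly independent over $\mathbb{Q}$, where $\boldsymbol{e}_{i}$ is the standard basis of $\mathbb{R}^{r}$. *)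

theory Defs
  imports "HOL-Analysis.Analysis" "HOL-Algebra.Coset"
begin
definition quotient_topology :: "'a topology \<Rightarrow> ('a \<Rightarrow> 'b) \<Rightarrow> 'b topology" where
  "quotient_topology X f =
     topology (\<lambda>V. V \<subseteq> f ` topspace X \<and> openin X {x \<in> topspace X. f x \<in> V})"

lemma openin_quotient_topology:
  "openin (quotient_topology X f) V \<longleftrightarrow>
     V \<subseteq> f ` topspace X \<and> openin X {x \<in> topspace X. f x \<in> V}"
proof -
  have "istopology (\<lambda>V. V \<subseteq> f ` topspace X \<and> openin X {x \<in> topspace X. f x \<in> V})"
    unfolding istopology_def
  proof (intro conjI allI impI)
    fix S T
    assume S: "S \<subseteq> f ` topspace X \<and> openin X {x \<in> topspace X. f x \<in> S}"
      and T: "T \<subseteq> f ` topspace X \<and> openin X {x \<in> topspace X. f x \<in> T}"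
    show "S \<inter> T \<subseteq> f ` topspace X"
      using S by blast
    have "{x \<in> topspace X. f x \<in> S \<inter> T} =
        {x \<in> topspace X. f x \<in> S} \<inter> {x \<in> topspace X. f x \<in> T}"
      by blast
    then show "openin X {x \<in> topspace X. f x \<in> S \<inter> T}"
      using openin_Int[OF conjunct2[OF S] conjunct2[OF T]] by (simp only:)
  next
    fix K
    assume K: "\<forall>V\<in>K. V \<subseteq> f ` topspace X \<and> openin X {x \<in> topspace X. f x \<in> V}"
    show "\<Union> K \<subseteq> f ` topspace X"
      using K by blast
    have "{x \<in> topspace X. f x \<in> \<Union> K} = \<Union> ((\<lambda>V. {x \<in> topspace X. f x \<in> V}) ` K)"
      by blast
    moreover have "openin X (\<Union> ((\<lambda>V. {x \<in> topspace X. f x \<in> V}) ` K))"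
      using K by (intro openin_Union) blast
    ultimately show "openin X {x \<in> topspace X. f x \<in> \<Union> K}"
      by (simp only:)
  qed
  then show ?thesis
    unfolding quotient_topology_def by (simp only: topology_inverse')
qed

lemma topspace_quotient_topology: "topspace (quotient_topology X f) = f ` topspace X"
proof -
  have "{x \<in> topspace X. f x \<in> f ` topspace X} = topspace X" by auto
  then have "openin (quotient_topology X f) (f ` topspace X)"
    by (simp add: openin_quotient_topology)
  moreover have "topspace (quotient_topology X f) \<subseteq> f ` topspace X"
    using openin_topspace[of "quotient_topology X f"] unfolding openin_quotient_topology
    by (rule conjunct1)
  ultimately show ?thesis
    by (intro subset_antisym openin_subset)
qed

lemma quotient_map_quotient_topology: "quotient_map X (quotient_topology X f) f"
  by (simp add: quotient_map_def topspace_quotient_topology openin_quotient_topology)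

definition top_group_iso ::
    "'a monoid \<Rightarrow> 'a topology \<Rightarrow> 'b monoid \<Rightarrow> 'b topology \<Rightarrow> ('a \<Rightarrow> 'b) \<Rightarrow> bool" where
  "top_group_iso G X H Y f \<longleftrightarrow> f \<in> iso G H \<and> homeomorphic_map X Y f"

definition top_group_isomorphic ::
    "'a monoid \<Rightarrow> 'a topology \<Rightarrow> 'b monoid \<Rightarrow> 'b topology \<Rightarrow> bool" where
  "top_group_isomorphic G X H Y \<longleftrightarrow> (\<exists>f. top_group_iso G X H Y f)"

definition additive_group :: "'a::ab_group_add set \<Rightarrow> 'a monoid" where
  "additive_group S = \<lparr>carrier = S, mult = (+), one = 0\<rparr>"

definition coset_topology :: "('a::{topological_space, ab_group_add}) set \<Rightarrow> 'a set \<Rightarrow> 'a set topology"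
  where "coset_topology S N =
    quotient_topology (top_of_set S) (\<lambda>v. N #>\<^bsub>additive_group S\<^esub> v)"

definition nonprincipal_ultrafilter :: "nat filter \<Rightarrow> bool" where
  "nonprincipal_ultrafilter U \<longleftrightarrow>
     U \<noteq> bot \<and>
     (\<forall>P. eventually P U \<or> eventually (\<lambda>k. \<not> P k) U) \<and>
     (\<nexists>n. U = principal {n})"

definition star_class :: "nat filter \<Rightarrow> (nat \<Rightarrow> 'a) \<Rightarrow> (nat \<Rightarrow> 'a) set" where
  "star_class U x = {y. eventually (\<lambda>k. x k = y k) U}"

text \<open>The ultrapower of \<open>A\<close>, as a subset of the ultrapower \<open>star_set U UNIV\<close> of the whole type.
  In particular the ultrapower of \<open>\<int>\<^sup>n\<close> lies inside that of \<open>\<real>\<^sup>n\<close>, and the latter is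
  identified with the \<open>n\<close>-th power of the hyperreals by taking coordinates.\<close>

definition star_set :: "nat filter \<Rightarrow> 'a set \<Rightarrow> (nat \<Rightarrow> 'a) set set" where
  "star_set U A = {star_class U x | x. \<forall>k. x k \<in> A}"

definition star_const :: "nat filter \<Rightarrow> 'a \<Rightarrow> (nat \<Rightarrow> 'a) set" where
  "star_const U a = star_class U (\<lambda>_. a)"

text \<open>All sets in the unions below are equal, as the classes do not depend on the representatives.\<close>

definition star_map :: "nat filter \<Rightarrow> ('a \<Rightarrow> 'b) \<Rightarrow> (nat \<Rightarrow> 'a) set \<Rightarrow> (nat \<Rightarrow> 'b) set" where
  "star_map U f X = (\<Union>x\<in>X. star_class U (\<lambda>k. f (x k)))"

definition star_map2 ::
    "nat filter \<Rightarrow> ('a \<Rightarrow> 'b \<Rightarrow> 'c) \<Rightarrow> (nat \<Rightarrow> 'a) set \<Rightarrow> (nat \<Rightarrow> 'b) set \<Rightarrow> (nat \<Rightarrow> 'c) set" where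
  "star_map2 U f X Y = (\<Union>x\<in>X. \<Union>y\<in>Y. star_class U (\<lambda>k. f (x k) (y k)))"

lemma star_class_cong:
  assumes "eventually (\<lambda>k. x k = y k) U"
  shows "star_class U x = star_class U y"
proof -
  have "eventually (\<lambda>k. x k = z k) U = eventually (\<lambda>k. y k = z k) U" for z
    by (rule eventually_subst, rule eventually_mono[OF assms], simp)
  then show ?thesis by (simp add: star_class_def)
qed

lemma star_class_self: "x \<in> star_class U x"
  by (simp add: star_class_def)

lemma star_map_class: "star_map U f (star_class U x) = star_class U (\<lambda>k. f (x k))"
proof -
  have "star_class U (\<lambda>k. f (y k)) = star_class U (\<lambda>k. f (x k))" if "y \<in> star_class U x" for y
  proof (rule star_class_cong)
    have "eventually (\<lambda>k. x k = y k) U" using that by (simp add: star_class_def)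
    then show "eventually (\<lambda>k. f (y k) = f (x k)) U" by (rule eventually_mono) simp
  qed
  then show ?thesis unfolding star_map_def using star_class_self[of x U] by blast
qed

lemma star_map2_class:
  "star_map2 U f (star_class U x) (star_class U y) = star_class U (\<lambda>k. f (x k) (y k))"
proof -
  have "star_class U (\<lambda>k. f (x' k) (y' k)) = star_class U (\<lambda>k. f (x k) (y k))"
    if "x' \<in> star_class U x" "y' \<in> star_class U y" for x' y'
  proof (rule star_class_cong)
    have "eventually (\<lambda>k. x k = x' k \<and> y k = y' k) U"
      using that by (simp add: star_class_def eventually_conj)
    then show "eventually (\<lambda>k. f (x' k) (y' k) = f (x k) (y k)) U"
      by (rule eventually_mono) simp
  qed
  then show ?thesis unfolding star_map2_def
    using star_class_self[of x U] star_class_self[of y U] by blast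
qed

definition star_group :: "nat filter \<Rightarrow> (nat \<Rightarrow> 'a::ab_group_add) set set \<Rightarrow> (nat \<Rightarrow> 'a) set monoid"
  where "star_group U S = \<lparr>carrier = S, mult = star_map2 U (+), one = star_const U 0\<rparr>"

definition infinitesimals :: "nat filter \<Rightarrow> (nat \<Rightarrow> real) set set" where
  "infinitesimals U = {star_class U x | x. \<forall>e>0. eventually (\<lambda>k. \<bar>x k\<bar> < e) U}"

definition infinitesimal_vectors :: "nat filter \<Rightarrow> (nat \<Rightarrow> real^'n) set set" where
  "infinitesimal_vectors U =
     {X \<in> star_set U UNIV. \<forall>i. star_map U (\<lambda>v. v $ i) X \<in> infinitesimals U}"

definition int_vectors :: "(real^'n) set" where
  "int_vectors = {v. \<forall>i. v $ i \<in> \<int>}"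

definition perp_rel ::
    "nat filter \<Rightarrow> real^'s^'r \<Rightarrow> (nat \<Rightarrow> real^'s) set \<Rightarrow> (nat \<Rightarrow> real^'r) set \<Rightarrow> bool" where
  "perp_rel U \<Theta> N M \<longleftrightarrow>
     M \<in> star_set U int_vectors \<and>
     star_map2 U (-) (star_map U ((*v) \<Theta>) N) M \<in> infinitesimal_vectors U"

definition approx_set :: "nat filter \<Rightarrow> real^'s^'r \<Rightarrow> (nat \<Rightarrow> real^'s) set set" where
  "approx_set U \<Theta> = {N \<in> star_set U int_vectors. \<exists>M. perp_rel U \<Theta> N M}"

definition perp :: "nat filter \<Rightarrow> real^'s^'r \<Rightarrow> (nat \<Rightarrow> real^'s) set \<Rightarrow> (nat \<Rightarrow> real^'r) set" where
  "perp U \<Theta> N = (THE M. perp_rel U \<Theta> N M)"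

definition eps :: "nat filter \<Rightarrow> real^'s^'r \<Rightarrow> (nat \<Rightarrow> real^'s) set \<Rightarrow> (nat \<Rightarrow> real^'r) set" where
  "eps U \<Theta> N = star_map2 U (-) (star_map U ((*v) \<Theta>) N) (perp U \<Theta> N)"

definition eps_kernel :: "nat filter \<Rightarrow> real^'s^'r \<Rightarrow> (nat \<Rightarrow> real^'s) set set" where
  "eps_kernel U \<Theta> =
     kernel (star_group U (approx_set U \<Theta>)) (star_group U (infinitesimal_vectors U)) (eps U \<Theta>)"

definition std_kernel :: "nat filter \<Rightarrow> real^'s^'r \<Rightarrow> (real^'s) set" where
  "std_kernel U \<Theta> = {n \<in> int_vectors. star_const U n \<in> eps_kernel U \<Theta>}"

definition Gamma_lattice :: "nat filter \<Rightarrow> real^'s^'r \<Rightarrow> ((real^'s) \<times> (real^'r)) set" where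
  "Gamma_lattice U \<Theta> = {(n, \<Theta> *v n) | n. n \<in> std_kernel U \<Theta>}"

definition int_lattice :: "((real^'s) \<times> (real^'r)) set" where
  "int_lattice = int_vectors \<times> int_vectors"

definition torus :: "((real^'s) \<times> (real^'r)) set monoid" where
  "torus = additive_group UNIV Mod int_lattice"

definition torus_proj :: "(real^'s) \<times> (real^'r) \<Rightarrow> ((real^'s) \<times> (real^'r)) set" where
  "torus_proj v = int_lattice #>\<^bsub>additive_group UNIV\<^esub> v"

definition graph_space :: "real^'s^'r \<Rightarrow> ((real^'s) \<times> (real^'r)) set" where
  "graph_space \<Theta> = {(x, \<Theta> *v x) | x. True}"

definition leaf_group :: "real^'s^'r \<Rightarrow> ((real^'s) \<times> (real^'r)) set monoid" where
  "leaf_group \<Theta> = torus\<lparr>carrier := torus_proj ` graph_space \<Theta>\<rparr>"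

definition leaf_topology :: "real^'s^'r \<Rightarrow> ((real^'s) \<times> (real^'r)) set topology" where
  "leaf_topology \<Theta> = quotient_topology (top_of_set (graph_space \<Theta>)) torus_proj"

text \<open>The foliation is given by its leaves, each with its leaf topology: the coset through \<open>t\<close>
  carries the topology transported from the identity leaf by translation by \<open>t\<close>.\<close>

definition kronecker_foliation :: "real^'s^'r \<Rightarrow> ((real^'s) \<times> (real^'r)) set topology set" where
  "kronecker_foliation \<Theta> =
     (\<lambda>t. quotient_topology (leaf_topology \<Theta>) (\<lambda>l. l \<otimes>\<^bsub>torus\<^esub> t)) ` carrier torus"

lemma topspace_kronecker_foliation:
  "topspace ` kronecker_foliation \<Theta> = rcosets\<^bsub>torus\<^esub> carrier (leaf_group \<Theta>)"
proof -
  have "topspace (quotient_topology (leaf_topology \<Theta>) (\<lambda>l. l \<otimes>\<^bsub>torus\<^esub> t)) =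
      carrier (leaf_group \<Theta>) #>\<^bsub>torus\<^esub> t" for t
    by (simp add: topspace_quotient_topology leaf_topology_def leaf_group_def r_coset_def
        UNION_singleton_eq_range)
  then show ?thesis
    by (simp only: kronecker_foliation_def image_image RCOSETS_def UNION_singleton_eq_range)
qed

definition has_planar_leaves :: "real^'s^'r \<Rightarrow> bool" where
  "has_planar_leaves \<Theta> \<longleftrightarrow>
     (\<forall>F \<in> kronecker_foliation \<Theta>. F homeomorphic_space (euclidean :: (real^'s) topology))"

definition rat_independent :: "('i::finite \<Rightarrow> 'v::real_vector) \<Rightarrow> bool" where
  "rat_independent f \<longleftrightarrow>
     (\<forall>c :: 'i \<Rightarrow> rat. (\<Sum>i\<in>UNIV. of_rat (c i) *\<^sub>R f i) = 0 \<longrightarrow> (\<forall>i. c i = 0))"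

definition inhom_independent_columns :: "real^'s^'r \<Rightarrow> bool" where
  "inhom_independent_columns \<Theta> \<longleftrightarrow>
     rat_independent (case_sum (\<lambda>j. column j \<Theta>) (\<lambda>i. axis i 1))"

end

theory Submission
  imports Defs
begin

text \<open>For a standard vector \<open>n\<close> and integer vectors \<open>m k\<close>, the sequence \<open>\<Theta> *v n - m k\<close> can vanish on a
  set of the ultrafilter only if \<open>\<Theta> *v n\<close> is itself an integer vector. So the standard part of the kernel of \<open>\<epsilon>(\<Theta>)\<close> is the
  lattice \<open>K\<close> of all integer \<open>n\<close> with \<open>\<Theta> *v n\<close> integer (\<open>std_kernel_eq\<close>), and \<open>\<Gamma>(\<Theta>)\<close> is the
  intersection of the graph of \<open>\<Theta>\<close> with the integer lattice (\<open>Gamma_lattice_eq\<close>), that is, the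
  kernel of the projection of the graph to the torus.

  Both isomorphisms are then the first isomorphism theorem in its topological form
  (\<open>topological_first_isomorphism\<close>), applied to two homomorphisms on the graph with the same kernel
  \<open>\<Gamma>(\<Theta>)\<close>: the projection to the torus, and the first coordinate followed by reduction modulo
  \<open>K\<close>. Both are quotient maps, the first because the leaf topology is defined that way, the
  second because the first coordinate is a homeomorphism from the graph to \<open>\<real>\<^sup>s\<close>.

  All leaves are translates of the identity leaf, hence homeomorphic to \<open>\<real>\<^sup>s / K\<close>. As \<open>K\<close> is
  discrete, \<open>\<real>\<^sup>s \<rightarrow> \<real>\<^sup>s / K\<close> is a covering map. If the quotient is homeomorphic to \<open>\<real>\<^sup>s\<close>, it is
  simply connected, so that the covering is injective and \<open>K\<close> is trivial; the converse is clear
  (\<open>coset_topology_homeomorphic_euclidean_iff\<close>). Finally, \<open>K\<close> is trivial exactly if there is no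
  nontrivial integer relation between the columns of \<open>\<Theta>\<close> and the standard basis, and clearing
  denominators turns rational relations into integer ones
  (\<open>inhom_independent_columns_iff\<close>).\<close>

section \<open>Quotient maps and quotient groups\<close>

text \<open>A quotient map determines the topology of its target, so two quotient maps on one space with
  the same fibres have canonically homeomorphic targets.\<close>

lemma homeomorphic_map_between_quotients:
  assumes f: "quotient_map X Y f" and g: "quotient_map X Z g"
    and fibres: "\<And>x y. x \<in> topspace X \<Longrightarrow> y \<in> topspace X \<Longrightarrow> f x = f y \<longleftrightarrow> g x = g y"
    and h: "\<And>x. x \<in> topspace X \<Longrightarrow> h (f x) = g x"
  shows "homeomorphic_map Y Z h"
proof -
  have "quotient_map X Z (h \<circ> f)"
    using g by (rule quotient_map_eq) (simp add: h)
  then have "quotient_map Y Z h"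
    using quotient_map_compose_eq[OF f] by blast
  moreover have "inj_on h (topspace Y)"
    using fibres h by (auto simp: inj_on_def simp flip: quotient_imp_surjective_map[OF f])
  ultimately show ?thesis
    by (simp add: homeomorphic_map_def)
qed

lemma homeomorphic_map_quotient_topology_inj:
  assumes "inj_on f (topspace X)"
  shows "homeomorphic_map X (quotient_topology X f) f"
  using assms quotient_map_quotient_topology by (simp add: homeomorphic_map_def)

text \<open>The subgroups of interest (integer lattices, the graph, the kernel) all live in the additive
  group of a vector space, whence the fixed ambient group \<open>UNIV\<close>.\<close>

abbreviation additive_subgroup :: "'a::ab_group_add set \<Rightarrow> bool" where
  "additive_subgroup S \<equiv> subgroup S (additive_group UNIV)"

lemma additive_group_simps [simp]:
  "carrier (additive_group S) = S"
  "x \<otimes>\<^bsub>additive_group S\<^esub> y = x + y"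
  "\<one>\<^bsub>additive_group S\<^esub> = 0"
  by (simp_all add: additive_group_def)

lemma comm_group_additive_UNIV: "comm_group (additive_group UNIV)"
proof (rule comm_groupI)
  fix x :: 'a
  show "\<exists>y\<in>carrier (additive_group UNIV). y \<otimes>\<^bsub>additive_group UNIV\<^esub> x = \<one>\<^bsub>additive_group UNIV\<^esub>"
    by (rule bexI[of _ "- x"]) simp_all
qed (simp_all add: add_ac)

lemma group_additive_UNIV: "group (additive_group UNIV)"
  using comm_group_additive_UNIV by (rule comm_group.axioms(2))

lemma inv_additive_UNIV [simp]: "inv\<^bsub>additive_group UNIV\<^esub> x = - x"
  by (rule group.inv_equality[OF group_additive_UNIV]) simp_all

lemma additive_subgroup_iff:
  "additive_subgroup S \<longleftrightarrow> 0 \<in> S \<and> (\<forall>x\<in>S. \<forall>y\<in>S. x - y \<in> S)"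
proof
  assume S: "additive_subgroup S"
  have "x - y \<in> S" if "x \<in> S" "y \<in> S" for x y
    using subgroup.m_closed[OF S \<open>x \<in> S\<close> subgroup.m_inv_closed[OF S \<open>y \<in> S\<close>]] by simp
  then show "0 \<in> S \<and> (\<forall>x\<in>S. \<forall>y\<in>S. x - y \<in> S)"
    using subgroup.one_closed[OF S] by simp
next
  assume S: "0 \<in> S \<and> (\<forall>x\<in>S. \<forall>y\<in>S. x - y \<in> S)"
  then have neg: "- x \<in> S" if "x \<in> S" for x
    using that by (metis diff_0)
  have "x + y \<in> S" if "x \<in> S" "y \<in> S" for x y
    using S that(1) neg[OF that(2)] by (metis diff_minus_eq_add)
  with S neg show "additive_subgroup S"
    by (intro subgroup.intro) auto
qed

text \<open>This form makes the library results on subgroups, which are groups with a smaller carrier,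
  apply to \<open>additive_group S\<close>.\<close>

lemma additive_group_restrict: "additive_group S = (additive_group UNIV)\<lparr>carrier := S\<rparr>"
  by (simp add: additive_group_def)

lemma comm_group_additive_group:
  assumes "additive_subgroup S" shows "comm_group (additive_group S)"
  using group.subgroup_imp_group[OF group_additive_UNIV assms]
  by (intro group.group_comm_groupI) (simp_all add: additive_group_restrict[symmetric] add.commute)

text \<open>The coset does not depend on \<open>S\<close>: cosets in the graph and in the whole space are the same
  sets.\<close>

lemma additive_coset: "N #>\<^bsub>additive_group S\<^esub> v = (\<lambda>n. n + v) ` N"
  by (auto simp: r_coset_def)

lemma additive_coset_eq_iff:
  assumes "additive_subgroup N"
  shows "N #>\<^bsub>additive_group S\<^esub> v = N #>\<^bsub>additive_group S\<^esub> w \<longleftrightarrow> v - w \<in> N"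
proof
  assume "N #>\<^bsub>additive_group S\<^esub> v = N #>\<^bsub>additive_group S\<^esub> w"
  moreover have "0 + v \<in> (\<lambda>n. n + v) ` N"
    using assms unfolding additive_subgroup_iff by blast
  ultimately show "v - w \<in> N"
    by (auto simp: additive_coset)
next
  assume d: "v - w \<in> N"
  have sub: "(\<lambda>n. n + a) ` N \<subseteq> (\<lambda>n. n + b) ` N" if "b - a \<in> N" for a b
  proof (rule image_subsetI)
    fix n assume "n \<in> N"
    then have "n - (b - a) \<in> N"
      using assms that unfolding additive_subgroup_iff by blast
    then show "n + a \<in> (\<lambda>n. n + b) ` N"
      by (rule rev_image_eqI) simp
  qed
  have "w - v \<in> N"
    using assms d unfolding additive_subgroup_iff by (metis diff_0 minus_diff_eq)
  with d show "N #>\<^bsub>additive_group S\<^esub> v = N #>\<^bsub>additive_group S\<^esub> w"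
    unfolding additive_coset by (intro subset_antisym sub)
qed

lemma additive_coset_eq_self_iff:
  assumes "additive_subgroup N"
  shows "N #>\<^bsub>additive_group S\<^esub> v = N \<longleftrightarrow> v \<in> N"
proof -
  have "N #>\<^bsub>additive_group S\<^esub> 0 = N"
    by (simp add: additive_coset)
  then show ?thesis
    using additive_coset_eq_iff[OF assms, of S v 0] by (simp only: diff_0_right)
qed

lemma additive_normal:
  "additive_subgroup N \<Longrightarrow> N \<lhd> additive_group UNIV"
  by (rule comm_group.subgroup_imp_normal[OF comm_group_additive_UNIV])

lemma quotient_map_coset_topology:
  "quotient_map (top_of_set S) (coset_topology S N) (\<lambda>v. N #>\<^bsub>additive_group S\<^esub> v)"
  unfolding coset_topology_def by (rule quotient_map_quotient_topology)

text \<open>The algebraic isomorphism \<open>G / ker h \<cong> H\<close> is a homeomorphism because the coset map and \<open>h\<close>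
  are quotient maps with the same fibres.\<close>

lemma topological_first_isomorphism:
  fixes S :: "'a::{topological_space, ab_group_add} set"
  assumes S: "additive_subgroup S" and H: "group H"
    and hom: "h \<in> hom (additive_group S) H" and onto: "h ` S = carrier H"
    and quot: "quotient_map (top_of_set S) Y h"
    and N: "N = kernel (additive_group S) H h"
  shows "top_group_iso (additive_group S Mod N) (coset_topology S N) H Y (\<lambda>C. the_elem (h ` C))"
proof -
  interpret G: comm_group "additive_group S"
    by (rule comm_group_additive_group[OF S])
  interpret h: group_hom "additive_group S" H h
    using H hom by (simp add: group_hom_def group_hom_axioms_def G.is_group)
  have sub: "additive_subgroup N"
    using group.incl_subgroup[OF group_additive_UNIV S, of N] h.subgroup_kernel
    by (simp add: N additive_group_restrict[symmetric])
  have fibres: "N #>\<^bsub>additive_group S\<^esub> v = N #>\<^bsub>additive_group S\<^esub> w \<longleftrightarrow> h v = h w"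
    if v: "v \<in> S" and w: "w \<in> S" for v w
  proof -
    have d: "v - w \<in> S"
      using S v w by (simp add: additive_subgroup_iff)
    have "h v = h (v - w) \<otimes>\<^bsub>H\<^esub> h w"
      using h.hom_mult[of "v - w" w] d w by simp
    then have "h v = h w \<longleftrightarrow> h (v - w) = \<one>\<^bsub>H\<^esub>"
      using d w h.hom_closed h.H.l_cancel_one by simp
    also have "\<dots> \<longleftrightarrow> v - w \<in> N"
      using d by (simp add: N kernel_def)
    finally show ?thesis
      by (simp add: additive_coset_eq_iff[OF sub])
  qed
  have h_coset: "the_elem (h ` (N #>\<^bsub>additive_group S\<^esub> v)) = h v" if v: "v \<in> S" for v
  proof -
    have "h (n + v) = h v" if "n \<in> N" for n
      using that v h.hom_mult[of n v] h.hom_closed[of v] by (simp add: N kernel_def)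
    moreover have "N \<noteq> {}"
      using sub by (auto simp: additive_subgroup_iff)
    ultimately have "h ` (N #>\<^bsub>additive_group S\<^esub> v) = {h v}"
      by (simp add: additive_coset image_image image_constant_conv cong: image_cong_simp)
    then show ?thesis by simp
  qed
  have "homeomorphic_map (coset_topology S N) Y (\<lambda>C. the_elem (h ` C))"
    by (rule homeomorphic_map_between_quotients[OF quotient_map_coset_topology quot])
      (simp_all add: fibres h_coset)
  moreover have "(\<lambda>C. the_elem (h ` C)) \<in> iso (additive_group S Mod N) H"
    unfolding N by (rule h.FactGroup_iso_set) (simp add: onto)
  ultimately show ?thesis
    by (simp add: top_group_iso_def)
qed

section \<open>The standard part of the kernel\<close>

lemma int_vectors_0 [simp]: "0 \<in> int_vectors"
  by (simp add: int_vectors_def)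

lemma int_vectors_diff [simp]: "v \<in> int_vectors \<Longrightarrow> w \<in> int_vectors \<Longrightarrow> v - w \<in> int_vectors"
  by (simp add: int_vectors_def)

lemma int_vector_norm_less_1:
  assumes "v \<in> int_vectors" "norm v < 1"
  shows "v = 0"
proof -
  have "v $ i = 0" for i
    using assms component_le_norm_cart[of v i] Ints_nonzero_abs_less1[of "v $ i"]
    by (auto simp: int_vectors_def)
  then show ?thesis by (simp add: vec_eq_iff)
qed

lemma star_class_eq_iff: "star_class U x = star_class U y \<longleftrightarrow> eventually (\<lambda>k. x k = y k) U"
proof
  assume "star_class U x = star_class U y"
  then have "y \<in> star_class U x" using star_class_self by metis
  then show "eventually (\<lambda>k. x k = y k) U" by (simp add: star_class_def)
qed (rule star_class_cong)

text \<open>Membership in the set of classes asks only for some infinitesimal representative; in fact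
  every representative is infinitesimal.\<close>

lemma star_class_in_infinitesimals:
  "star_class U x \<in> infinitesimals U \<longleftrightarrow> (\<forall>e>0. eventually (\<lambda>k. \<bar>x k\<bar> < e) U)"
proof
  assume "star_class U x \<in> infinitesimals U"
  then obtain y where xy: "eventually (\<lambda>k. x k = y k) U"
    and y: "\<forall>e>0. eventually (\<lambda>k. \<bar>y k\<bar> < e) U"
    by (auto simp: infinitesimals_def star_class_eq_iff)
  show "\<forall>e>0. eventually (\<lambda>k. \<bar>x k\<bar> < e) U"
  proof (intro allI impI)
    fix e :: real assume "e > 0"
    with y have "eventually (\<lambda>k. \<bar>y k\<bar> < e) U" by blast
    with xy show "eventually (\<lambda>k. \<bar>x k\<bar> < e) U"
      by eventually_elim simp
  qed
qed (auto simp: infinitesimals_def)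

lemma star_class_in_infinitesimal_vectors:
  "star_class U x \<in> infinitesimal_vectors U \<longleftrightarrow>
     (\<forall>i. \<forall>e>0. eventually (\<lambda>k. \<bar>x k $ i\<bar> < e) U)"
  by (auto simp: infinitesimal_vectors_def star_set_def star_map_class star_class_in_infinitesimals)

lemma perp_rel_class:
  "perp_rel U \<Theta> (star_class U n) (star_class U m) \<longleftrightarrow>
     star_class U m \<in> star_set U int_vectors \<and>
     (\<forall>i. \<forall>e>0. eventually (\<lambda>k. \<bar>(\<Theta> *v n k - m k) $ i\<bar> < e) U)"
  by (simp add: perp_rel_def star_map_class star_map2_class star_class_in_infinitesimal_vectors)

text \<open>Two integer vectors at distance less than \<open>1/2\<close> from the same point in each coordinate
  coincide. The indices where this happens for all of the finitely many coordinates still form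
  a set of the filter.\<close>

lemma perp_rel_unique:
  assumes "perp_rel U \<Theta> (star_class U n) M" "perp_rel U \<Theta> (star_class U n) M'"
  shows "M = M'"
proof -
  obtain m m' where m: "M = star_class U m" "\<And>k. m k \<in> int_vectors"
    and m': "M' = star_class U m'" "\<And>k. m' k \<in> int_vectors"
    using assms unfolding perp_rel_def star_set_def by blast
  have "eventually (\<lambda>k. m k $ i = m' k $ i) U" for i
  proof -
    \<comment> \<open>Any bound of at most \<open>1/2\<close> separates distinct integers.\<close>
    have "eventually (\<lambda>k. \<bar>(\<Theta> *v n k - m k) $ i\<bar> < 1/2) U"
      "eventually (\<lambda>k. \<bar>(\<Theta> *v n k - m' k) $ i\<bar> < 1/2) U"
      using assms[unfolded m(1) m'(1) perp_rel_class] half_gt_zero[OF zero_less_one] by blast+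
    then show ?thesis
    proof eventually_elim
      case (elim k)
      then have "\<bar>m k $ i - m' k $ i\<bar> < 1"
        unfolding vector_minus_component by linarith
      moreover have "m k $ i - m' k $ i \<in> \<int>"
        using m(2)[of k] m'(2)[of k] by (simp add: int_vectors_def)
      ultimately show ?case
        using Ints_nonzero_abs_less1 by fastforce
    qed
  qed
  then have "eventually (\<lambda>k. \<forall>i. m k $ i = m' k $ i) U"
    by (rule eventually_all_finite)
  then show ?thesis
    by (simp add: m m' star_class_eq_iff vec_eq_iff)
qed

text \<open>By uniqueness, \<open>\<epsilon>(\<Theta>)\<close> may be computed from any representative of the nearest integer
  vector, without the description operator in its definition.\<close>

lemma eps_eqI:
  assumes "perp_rel U \<Theta> (star_class U n) (star_class U m)"
  shows "eps U \<Theta> (star_class U n) = star_class U (\<lambda>k. \<Theta> *v n k - m k)"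
proof -
  have "perp U \<Theta> (star_class U n) = star_class U m"
    unfolding perp_def using assms perp_rel_unique by (intro the_equality)
  then show ?thesis
    by (simp add: eps_def star_map_class star_map2_class)
qed

text \<open>If \<open>\<epsilon>(\<Theta>)\<close> vanishes at the standard vector \<open>n\<close>, then \<open>\<Theta> *v n = m k\<close> for some index
  \<open>k\<close>, with \<open>m k\<close> an integer vector. Conversely, an integer vector \<open>\<Theta> *v n\<close> is its own
  nearest integer vector.\<close>

lemma std_kernel_eq:
  assumes "U \<noteq> bot"
  shows "std_kernel U \<Theta> = {n \<in> int_vectors. \<Theta> *v n \<in> int_vectors}"
proof (intro Set.set_eqI iffI)
  fix n assume n: "n \<in> std_kernel U \<Theta>"
  then have ker: "eps U \<Theta> (star_const U n) = star_const U 0"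
    and "star_const U n \<in> approx_set U \<Theta>" and int: "n \<in> int_vectors"
    by (simp_all add: std_kernel_def eps_kernel_def kernel_def star_group_def)
  then obtain M where M: "perp_rel U \<Theta> (star_const U n) M"
    by (auto simp: approx_set_def)
  then obtain m where m: "M = star_class U m" "\<And>k. m k \<in> int_vectors"
    unfolding perp_rel_def star_set_def by blast
  have "eventually (\<lambda>k. \<Theta> *v n = m k) U"
    using M ker eps_eqI[of U \<Theta> "\<lambda>_. n" m]
    by (simp add: m(1) star_const_def star_class_eq_iff)
  then obtain k where "\<Theta> *v n = m k"
    using assms eventually_happens by blast
  with int m(2) show "n \<in> {n \<in> int_vectors. \<Theta> *v n \<in> int_vectors}"
    by simp
next
  fix n assume "n \<in> {n \<in> int_vectors. \<Theta> *v n \<in> int_vectors}"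
  then have n: "n \<in> int_vectors" "\<Theta> *v n \<in> int_vectors" by simp_all
  have perp: "perp_rel U \<Theta> (star_class U (\<lambda>_. n)) (star_class U (\<lambda>_. \<Theta> *v n))"
    using n by (auto simp: perp_rel_class star_set_def)
  then have "star_const U n \<in> approx_set U \<Theta>"
    using n by (auto simp: approx_set_def star_const_def star_set_def)
  moreover have "eps U \<Theta> (star_const U n) = star_const U 0"
    using eps_eqI[OF perp] by (simp add: star_const_def)
  ultimately show "n \<in> std_kernel U \<Theta>"
    using n by (simp add: std_kernel_def eps_kernel_def kernel_def star_group_def)
qed

lemma Gamma_lattice_eq:
  assumes "U \<noteq> bot"
  shows "Gamma_lattice U \<Theta> = graph_space \<Theta> \<inter> int_lattice"
  by (auto simp: Gamma_lattice_def std_kernel_eq[OF assms] graph_space_def int_lattice_def)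

lemma additive_subgroup_std_kernel:
  assumes "U \<noteq> bot"
  shows "additive_subgroup (std_kernel U \<Theta>)"
  by (auto simp: std_kernel_eq[OF assms] additive_subgroup_iff matrix_vector_mult_diff_distrib)

section \<open>The identity leaf as a quotient\<close>

lemma additive_subgroup_int_lattice: "additive_subgroup int_lattice"
  by (auto simp: additive_subgroup_iff int_lattice_def zero_prod_def)

lemma additive_subgroup_graph_space: "additive_subgroup (graph_space \<Theta>)"
  by (auto simp: additive_subgroup_iff graph_space_def zero_prod_def
      matrix_vector_mult_diff_distrib)

lemma group_torus: "group torus"
  unfolding torus_def
  by (rule normal.factorgroup_is_group[OF additive_normal[OF additive_subgroup_int_lattice]])

lemma torus_proj_hom: "torus_proj \<in> hom (additive_group UNIV) torus"
  using normal.r_coset_hom_Mod[OF additive_normal[OF additive_subgroup_int_lattice]]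
  unfolding torus_def torus_proj_def .

lemma one_torus: "\<one>\<^bsub>torus\<^esub> = int_lattice"
  by (simp add: torus_def FactGroup_def)

lemma torus_proj_eq_one_iff: "torus_proj v = int_lattice \<longleftrightarrow> v \<in> int_lattice"
  unfolding torus_proj_def by (rule additive_coset_eq_self_iff[OF additive_subgroup_int_lattice])

lemma subgroup_leaf: "subgroup (torus_proj ` graph_space \<Theta>) torus"
proof -
  interpret group_hom "additive_group UNIV" torus torus_proj
    by (simp add: group_hom_def group_hom_axioms_def group_additive_UNIV group_torus torus_proj_hom)
  show ?thesis
    by (rule subgroup_img_is_subgroup[OF additive_subgroup_graph_space])
qed

lemma group_leaf: "group (leaf_group \<Theta>)"
  unfolding leaf_group_def
  by (rule group.subgroup_imp_group[OF group_torus subgroup_leaf])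

text \<open>The projection to the torus, restricted to the graph, has kernel \<open>\<Gamma>(\<Theta>)\<close> and is a quotient map
  for the leaf topology by definition.\<close>

lemma leaf_is_graph_mod_Gamma:
  assumes "U \<noteq> bot"
  shows "top_group_iso
      (additive_group (graph_space \<Theta>) Mod Gamma_lattice U \<Theta>)
      (coset_topology (graph_space \<Theta>) (Gamma_lattice U \<Theta>))
      (leaf_group \<Theta>) (leaf_topology \<Theta>)
      (\<lambda>C. the_elem (torus_proj ` C))"
proof (rule topological_first_isomorphism[OF additive_subgroup_graph_space group_leaf])
  show "torus_proj \<in> hom (additive_group (graph_space \<Theta>)) (leaf_group \<Theta>)"
    using hom_mult[OF torus_proj_hom] by (intro homI) (simp_all add: leaf_group_def)
  show "torus_proj ` graph_space \<Theta> = carrier (leaf_group \<Theta>)"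
    by (simp add: leaf_group_def)
  show "quotient_map (top_of_set (graph_space \<Theta>)) (leaf_topology \<Theta>) torus_proj"
    unfolding leaf_topology_def by (rule quotient_map_quotient_topology)
  show "Gamma_lattice U \<Theta> = kernel (additive_group (graph_space \<Theta>)) (leaf_group \<Theta>) torus_proj"
    by (auto simp: Gamma_lattice_eq[OF assms] kernel_def leaf_group_def one_torus
        torus_proj_eq_one_iff)
qed

lemma homeomorphic_map_fst_graph:
  fixes \<Theta> :: "real^'s^'r"
  shows "homeomorphic_map (top_of_set (graph_space \<Theta>)) euclidean fst"
proof -
  have "homeomorphic_maps (top_of_set (graph_space \<Theta>)) euclidean fst (\<lambda>x. (x, \<Theta> *v x))"
    by (auto simp: homeomorphic_maps_def graph_space_def continuous_map_in_subtopology
        intro!: continuous_intros matrix_vector_mult_linear_continuous_on)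
  then show ?thesis by (rule homeomorphic_maps_imp_map)
qed

text \<open>The first coordinate identifies the graph with \<open>\<real>\<^sup>s\<close> and \<open>\<Gamma>(\<Theta>)\<close> with the standard kernel,
  so reduction of the first coordinate has kernel \<open>\<Gamma>(\<Theta>)\<close>.\<close>

lemma graph_mod_Gamma_isomorphic:
  assumes "U \<noteq> bot"
  shows "top_group_isomorphic
      (additive_group (graph_space \<Theta>) Mod Gamma_lattice U \<Theta>)
      (coset_topology (graph_space \<Theta>) (Gamma_lattice U \<Theta>))
      (additive_group UNIV Mod std_kernel U \<Theta>)
      (coset_topology UNIV (std_kernel U \<Theta>))"
proof -
  let ?K = "std_kernel U \<Theta>"
  let ?q = "\<lambda>x. ?K #>\<^bsub>additive_group UNIV\<^esub> x"
  note K = additive_subgroup_std_kernel[OF assms, of \<Theta>]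
  have surj: "fst ` graph_space \<Theta> = UNIV"
    by (force simp: graph_space_def)
  have "top_group_iso
      (additive_group (graph_space \<Theta>) Mod Gamma_lattice U \<Theta>)
      (coset_topology (graph_space \<Theta>) (Gamma_lattice U \<Theta>))
      (additive_group UNIV Mod ?K) (coset_topology UNIV ?K)
      (\<lambda>C. the_elem ((?q \<circ> fst) ` C))"
  proof (rule topological_first_isomorphism[OF additive_subgroup_graph_space])
    show "group (additive_group UNIV Mod ?K)"
      by (rule normal.factorgroup_is_group[OF additive_normal[OF K]])
    show "?q \<circ> fst \<in> hom (additive_group (graph_space \<Theta>)) (additive_group UNIV Mod ?K)"
      using normal.r_coset_hom_Mod[OF additive_normal[OF K]] by (simp add: hom_def Pi_def)
    show "(?q \<circ> fst) ` graph_space \<Theta> = carrier (additive_group UNIV Mod ?K)"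
      by (simp only: image_comp[symmetric] surj)
        (auto simp: FactGroup_def RCOSETS_def)
    show "quotient_map (top_of_set (graph_space \<Theta>)) (coset_topology UNIV ?K) (?q \<circ> fst)"
      using homeomorphic_map_fst_graph[of \<Theta>, unfolded homeomorphic_map_def, THEN conjunct1]
        quotient_map_coset_topology[of UNIV ?K]
      by (simp add: quotient_map_compose)
    have "?q x = ?K \<longleftrightarrow> x \<in> ?K" for x
      by (rule additive_coset_eq_self_iff[OF K])
    then show "Gamma_lattice U \<Theta> =
        kernel (additive_group (graph_space \<Theta>)) (additive_group UNIV Mod ?K) (?q \<circ> fst)"
      by (auto simp: kernel_def FactGroup_def Gamma_lattice_def graph_space_def)
  qed
  then show ?thesis
    unfolding top_group_isomorphic_def by blast
qed

section \<open>Planarity and the discrete subgroup\<close>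

text \<open>A simply connected base admits a section \<open>g\<close> through any chosen point \<open>x\<close>. Both \<open>g \<circ> p\<close> and the
  identity are lifts of \<open>p\<close> that agree at \<open>x\<close>, so they are equal on the connected space \<open>C\<close>, and
  \<open>g\<close> is a left inverse of \<open>p\<close>.\<close>

lemma covering_space_simply_connected_inj_on:
  fixes p :: "'a::real_normed_vector \<Rightarrow> 'b::real_normed_vector"
  assumes cov: "covering_space C p S" and C: "connected C"
    and S: "simply_connected S" "locally path_connected S"
  shows "inj_on p C"
proof (rule inj_onI)
  fix x y assume x: "x \<in> C" and y: "y \<in> C" and xy: "p x = p y"
  have pC: "p \<in> C \<rightarrow> S" and contp: "continuous_on C p"
    using cov by (auto simp: covering_space_def)
  have px: "p x \<in> S" using pC x by blast
  obtain g where g: "continuous_on S g" "g \<in> S \<rightarrow> C" "g (p x) = x" "\<And>z. z \<in> S \<Longrightarrow> p (g z) = z"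
    by (rule covering_space_lift_strong[OF cov x px S continuous_on_id, of thesis]) auto
  have "(g \<circ> p) y = id y"
  proof (rule covering_space_lift_unique[where f = p and ?g1.0 = "g \<circ> p" and ?g2.0 = id and a = x and T = C,
        OF cov])
    show "continuous_on C (g \<circ> p)"
      using contp g(1) pC by (intro continuous_on_compose) (auto intro: continuous_on_subset)
  qed (use x y g pC contp C in \<open>auto simp: Pi_iff\<close>)
  then have "g (p y) = y" by simp
  with g(3) show "x = y"
    unfolding xy by (rule trans[OF sym])
qed

text \<open>If nonzero elements of \<open>K\<close> have norm at least \<open>r\<close>, the image of a ball of radius \<open>r/2\<close> is evenly
  covered: its preimage is the disjoint union of the \<open>K\<close>-translates of the ball. The map \<open>p\<close> is
  open because the saturation of an open set is a union of translates.\<close>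

lemma covering_space_discrete_quotient:
  fixes p :: "'a::real_normed_vector \<Rightarrow> 'b::topological_space"
  assumes K: "additive_subgroup K" and r: "r > 0"
    and discrete: "\<And>k. k \<in> K \<Longrightarrow> norm k < r \<Longrightarrow> k = 0"
    and quot: "quotient_map euclidean euclidean p"
    and fibres: "\<And>x y. p x = p y \<longleftrightarrow> x - y \<in> K"
  shows "covering_space UNIV p UNIV"
proof -
  have contp: "continuous_on A p" for A
    using quotient_imp_continuous_map[OF quot] continuous_on_subset by auto
  have surj: "range p = UNIV"
    using quotient_imp_surjective_map[OF quot] by simp
  have openp: "open (p ` W)" if "open W" for W
  proof -
    have "p -` (p ` W) = (\<Union>k\<in>K. (+) k ` W)"
    proof (intro Set.set_eqI iffI)
      fix x assume "x \<in> p -` (p ` W)"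
      then obtain w where "w \<in> W" "x - w \<in> K" by (auto simp: fibres)
      then have "x \<in> (+) (x - w) ` W" by (intro image_eqI[of _ _ w]) simp_all
      with \<open>x - w \<in> K\<close> show "x \<in> (\<Union>k\<in>K. (+) k ` W)" by blast
    next
      fix x assume "x \<in> (\<Union>k\<in>K. (+) k ` W)"
      then obtain k w where "k \<in> K" "w \<in> W" "x = k + w" by blast
      then have "p x = p w" by (simp add: fibres)
      with \<open>w \<in> W\<close> show "x \<in> p -` (p ` W)" by simp
    qed
    also have "open \<dots>"
      using that by (intro open_UN ballI open_translation)
    finally show ?thesis
      using quot unfolding quotient_map_def by (simp add: vimage_def)
  qed
  have inj: "inj_on p (ball x (r/2))" for x
  proof (rule inj_onI)
    fix a b assume ab: "a \<in> ball x (r/2)" "b \<in> ball x (r/2)" "p a = p b"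
    then have "norm (a - b) < r"
      using dist_triangle_half_r[of x a r b] by (simp add: dist_norm)
    with ab show "a = b"
      using discrete[of "a - b"] by (simp add: fibres)
  qed
  have "\<exists>T. y \<in> T \<and> openin (top_of_set UNIV) T \<and>
          (\<exists>v. \<Union>v = UNIV \<inter> p -` T \<and>
               (\<forall>u\<in>v. openin (top_of_set UNIV) u) \<and> pairwise disjnt v \<and>
               (\<forall>u\<in>v. \<exists>q. homeomorphism u T p q))" for y
  proof -
    obtain x where y: "y = p x" using surj by blast
    let ?B = "\<lambda>k. ball (x + k) (r/2)"
    let ?T = "p ` ball x (r/2)"
    have image: "p ` ?B k = ?T" if k: "k \<in> K" for k
    proof -
      have "?B k = (\<lambda>z. z + k) ` ball x (r/2)"
        using ball_translation[of k x "r/2"] by (simp add: add.commute)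
      moreover have "p (z + k) = p z" for z
        using k by (simp add: fibres)
      ultimately show ?thesis by (simp add: image_image)
    qed
    have "\<Union> (?B ` K) = UNIV \<inter> p -` ?T"
    proof (intro Set.set_eqI iffI)
      fix z assume "z \<in> \<Union> (?B ` K)"
      then show "z \<in> UNIV \<inter> p -` ?T" using image by blast
    next
      fix z assume "z \<in> UNIV \<inter> p -` ?T"
      then obtain w where w: "w \<in> ball x (r/2)" "z - w \<in> K" by (auto simp: fibres)
      then have "z \<in> ?B (z - w)" by (simp add: dist_norm algebra_simps)
      with w show "z \<in> \<Union> (?B ` K)" by blast
    qed
    moreover have "pairwise disjnt (?B ` K)"
    proof (intro pairwiseI)
      fix A B assume "A \<in> ?B ` K" "B \<in> ?B ` K" "A \<noteq> B"
      then obtain k l where kl: "k \<in> K" "l \<in> K" "A = ?B k" "B = ?B l" "k \<noteq> l" by blast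
      have "k - l \<in> K" using K kl by (simp add: additive_subgroup_iff)
      then have "r \<le> norm (k - l)" using discrete[of "k - l"] kl(5) by (intro leI notI) simp
      then show "disjnt A B"
        unfolding kl(3,4) disjnt_def by (intro disjoint_ballI) (simp add: dist_norm)
    qed
    moreover have "\<exists>q. homeomorphism u ?T p q" if u: "u \<in> ?B ` K" for u
    proof -
      obtain k where k: "k \<in> K" "u = ?B k" using u by blast
      show ?thesis
      proof (rule homeomorphism_injective_open_map[of u p ?T])
        fix W assume W: "openin (top_of_set u) W"
        then have "open W" "W \<subseteq> u"
          using k(2) by (simp_all add: openin_open_eq)
        moreover from \<open>W \<subseteq> u\<close> have "p ` W \<subseteq> ?T"
          unfolding image[OF k(1), symmetric] k(2) by (rule image_mono)
        ultimately show "openin (top_of_set ?T) (p ` W)"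
          using openp by (intro open_subset)
      next
        show "p ` u = ?T" using image k by simp
        show "inj_on p u" using inj k by simp
      qed (rule contp, rule exI)
    qed
    moreover have "y \<in> ?T"
      unfolding y using r by (intro imageI) simp
    moreover have "openin (top_of_set UNIV) ?T"
      using openp[OF open_ball] by simp
    moreover have "openin (top_of_set UNIV) u" if "u \<in> ?B ` K" for u
      using that by (auto simp: open_openin[symmetric])
    ultimately show ?thesis
      by (intro exI[of _ ?T] conjI exI[of _ "?B ` K"] ballI)
  qed
  then show ?thesis
    unfolding covering_space_def by (intro conjI ballI contp surj)
qed

text \<open>A homeomorphism from the quotient to the space turns the coset map into a covering of the
  space by itself, which must be injective by simple connectedness.\<close>

lemma coset_topology_homeomorphic_euclidean_iff:
  fixes K :: "'a::real_normed_vector set"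
  assumes K: "additive_subgroup K" and r: "r > 0"
    and discrete: "\<And>k. k \<in> K \<Longrightarrow> norm k < r \<Longrightarrow> k = 0"
  shows "coset_topology UNIV K homeomorphic_space (euclidean :: 'a topology) \<longleftrightarrow> K = {0}"
proof
  let ?q = "\<lambda>x. K #>\<^bsub>additive_group UNIV\<^esub> x"
  assume "coset_topology UNIV K homeomorphic_space (euclidean :: 'a topology)"
  then obtain \<phi> where \<phi>: "homeomorphic_map (coset_topology UNIV K) (euclidean :: 'a topology) \<phi>"
    by (auto simp: homeomorphic_space)
  have quot: "quotient_map euclidean (coset_topology UNIV K) ?q"
    using quotient_map_coset_topology[of UNIV K] by simp
  let ?p = "\<phi> \<circ> ?q"
  have "covering_space UNIV ?p UNIV"
  proof (rule covering_space_discrete_quotient[OF K r discrete])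
    show "quotient_map euclidean euclidean ?p"
      using quotient_map_compose[OF quot \<phi>[unfolded homeomorphic_map_def, THEN conjunct1]] .
    have "?q x \<in> topspace (coset_topology UNIV K)" for x
      using quotient_imp_surjective_map[OF quot] by auto
    then have "?p x = ?p y \<longleftrightarrow> ?q x = ?q y" for x y
      using inj_on_eq_iff[OF homeomorphic_imp_injective_map[OF \<phi>]] by simp
    then show "?p x = ?p y \<longleftrightarrow> x - y \<in> K" for x y
      by (simp only: additive_coset_eq_iff[OF K])
  qed
  then have "inj ?p"
    by (rule covering_space_simply_connected_inj_on)
      (simp_all add: connected_UNIV convex_imp_simply_connected convex_imp_locally_path_connected)
  have "k = 0" if "k \<in> K" for k
  proof -
    have "?q k = ?q 0"
      using that by (simp only: additive_coset_eq_iff[OF K] diff_0_right)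
    then have "?p k = ?p 0" by simp
    with \<open>inj ?p\<close> show ?thesis by (rule injD)
  qed
  moreover have "0 \<in> K" using K by (simp add: additive_subgroup_iff)
  ultimately show "K = {0}" by blast
next
  assume "K = {0}"
  have "homeomorphic_map (top_of_set UNIV) (coset_topology UNIV K) (\<lambda>x. K #>\<^bsub>additive_group UNIV\<^esub> x)"
    unfolding coset_topology_def
    by (rule homeomorphic_map_quotient_topology_inj) (simp add: \<open>K = {0}\<close> additive_coset inj_on_def)
  then have "(euclidean :: 'a topology) homeomorphic_space coset_topology UNIV K"
    unfolding subtopology_UNIV by (rule homeomorphic_map_imp_homeomorphic_space)
  then show "coset_topology UNIV K homeomorphic_space (euclidean :: 'a topology)"
    by (rule homeomorphic_space_sym[THEN iffD1])
qed

lemma homeomorphic_space_cong: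
  assumes "X homeomorphic_space Y"
  shows "X homeomorphic_space Z \<longleftrightarrow> Y homeomorphic_space Z"
proof
  assume "X homeomorphic_space Z"
  with assms[THEN homeomorphic_space_sym[THEN iffD1]] show "Y homeomorphic_space Z"
    by (rule homeomorphic_space_trans)
next
  assume "Y homeomorphic_space Z"
  with assms show "X homeomorphic_space Z"
    by (rule homeomorphic_space_trans)
qed

lemma leaf_topology_homeomorphic_quotient:
  assumes "U \<noteq> bot"
  shows "leaf_topology \<Theta> homeomorphic_space coset_topology UNIV (std_kernel U \<Theta>)"
proof -
  let ?X = "coset_topology (graph_space \<Theta>) (Gamma_lattice U \<Theta>)"
  have "?X homeomorphic_space leaf_topology \<Theta>"
    using leaf_is_graph_mod_Gamma[OF assms, of \<Theta>] homeomorphic_map_imp_homeomorphic_space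
    unfolding top_group_iso_def by blast
  moreover have "?X homeomorphic_space coset_topology UNIV (std_kernel U \<Theta>)"
    using graph_mod_Gamma_isomorphic[OF assms, of \<Theta>] homeomorphic_map_imp_homeomorphic_space
    unfolding top_group_isomorphic_def top_group_iso_def by blast
  ultimately show ?thesis
    by (rule homeomorphic_space_cong[THEN iffD1])
qed

text \<open>Translation is injective on the torus, so it is a homeomorphism onto the coset with the
  transported topology.\<close>

lemma leaf_homeomorphic_identity_leaf:
  assumes "F \<in> kronecker_foliation \<Theta>"
  shows "leaf_topology \<Theta> homeomorphic_space F"
proof -
  interpret torus: group torus by (rule group_torus)
  obtain t where t: "t \<in> carrier torus"
    and F: "F = quotient_topology (leaf_topology \<Theta>) (\<lambda>l. l \<otimes>\<^bsub>torus\<^esub> t)"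
    using assms by (auto simp: kronecker_foliation_def)
  have "topspace (leaf_topology \<Theta>) \<subseteq> carrier torus"
    using subgroup.subset[OF subgroup_leaf, of \<Theta>]
    by (simp add: leaf_topology_def topspace_quotient_topology)
  then have "inj_on (\<lambda>l. l \<otimes>\<^bsub>torus\<^esub> t) (topspace (leaf_topology \<Theta>))"
    using t by (simp add: inj_on_def subset_iff)
  then show ?thesis
    unfolding F
    by (rule homeomorphic_map_imp_homeomorphic_space[OF homeomorphic_map_quotient_topology_inj])
qed

text \<open>The constant \<open>1\<close> of discreteness is the least norm of a nonzero integer vector.\<close>

lemma has_planar_leaves_iff:
  fixes \<Theta> :: "real^'s^'r"
  assumes "U \<noteq> bot"
  shows "has_planar_leaves \<Theta> \<longleftrightarrow> std_kernel U \<Theta> = {0}"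
proof -
  have "kronecker_foliation \<Theta> \<noteq> {}"
    using group.is_monoid[OF group_torus] monoid.one_closed
    by (auto simp: kronecker_foliation_def)
  moreover have "F homeomorphic_space (euclidean :: (real^'s) topology) \<longleftrightarrow>
      leaf_topology \<Theta> homeomorphic_space (euclidean :: (real^'s) topology)"
    if "F \<in> kronecker_foliation \<Theta>" for F
    by (rule homeomorphic_space_cong[OF leaf_homeomorphic_identity_leaf[OF that], symmetric])
  ultimately have "has_planar_leaves \<Theta> \<longleftrightarrow>
      leaf_topology \<Theta> homeomorphic_space (euclidean :: (real^'s) topology)"
    unfolding has_planar_leaves_def by blast
  also have "\<dots> \<longleftrightarrow>
      coset_topology UNIV (std_kernel U \<Theta>) homeomorphic_space (euclidean :: (real^'s) topology)"
    by (rule homeomorphic_space_cong[OF leaf_topology_homeomorphic_quotient[OF assms]])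
  also have "\<dots> \<longleftrightarrow> std_kernel U \<Theta> = {0}"
    by (rule coset_topology_homeomorphic_euclidean_iff[OF additive_subgroup_std_kernel[OF assms], of 1])
      (simp_all add: std_kernel_eq[OF assms] int_vector_norm_less_1)
  finally show ?thesis .
qed

section \<open>Rational independence of the columns\<close>

lemma finite_common_denominator:
  fixes c :: "'i \<Rightarrow> rat"
  assumes "finite A"
  shows "\<exists>d::int. d > 0 \<and> (\<forall>i\<in>A. of_int d * c i \<in> \<int>)"
  using assms
proof induction
  case empty
  show ?case by (rule exI[of _ 1]) simp
next
  case (insert a A)
  then obtain d where d: "d > 0" "\<And>i. i \<in> A \<Longrightarrow> of_int d * c i \<in> \<int>" by blast
  obtain p q where pq: "q > 0" "c a = of_int p / of_int q"
    by (metis Fract_of_int_quotient Rat_cases)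
  have "of_int (d * q) * c i \<in> \<int>" if "i \<in> insert a A" for i
  proof (cases "i = a")
    case True
    then have "of_int (d * q) * c i = of_int (d * p)" using pq by simp
    then show ?thesis by (metis Ints_of_int)
  next
    case False
    then have "of_int q * (of_int d * c i) \<in> \<int>"
      using that d(2) by (metis Ints_mult Ints_of_int insertE)
    then show ?thesis by (simp add: mult_ac)
  qed
  with d pq show ?case by (intro exI[of _ "d * q"]) auto
qed

text \<open>A combination of the columns and the standard basis is \<open>\<Theta> *v a + b\<close> for the coefficient vectors
  \<open>a\<close> and \<open>b\<close>; rational relations thus become statements about \<open>\<Theta>\<close> as a map.\<close>

lemma sum_columns_and_axes:
  fixes \<Theta> :: "real^'s^'r"
  shows "(\<Sum>i\<in>UNIV. of_rat (c i) *\<^sub>R case_sum (\<lambda>j. column j \<Theta>) (\<lambda>i. axis i 1) i) =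
    \<Theta> *v (\<chi> j. of_rat (c (Inl j))) + (\<chi> i. of_rat (c (Inr i)))"
proof -
  have "(\<Sum>i\<in>UNIV. of_rat (c (Inr i)) *\<^sub>R axis i 1) = (\<chi> i::'r. (of_rat (c (Inr i)) :: real))"
    by (simp add: vec_eq_iff axis_def if_distrib sum.delta cong: if_cong)
  then show ?thesis
    by (simp add: UNIV_Plus_UNIV[symmetric] sum.Plus matrix_mult_sum scalar_mult_eq_scaleR
        del: UNIV_Plus_UNIV)
qed

text \<open>An integer \<open>n\<close> with integer image \<open>\<Theta> *v n\<close> is the rational relation with coefficients \<open>n\<close> and
  \<open>- (\<Theta> *v n)\<close>. Conversely, a common multiple of the denominators scales a relation \<open>\<Theta> *v a = - b\<close>
  to such an \<open>n\<close>; as \<open>n = 0\<close> forces \<open>a = 0\<close> and then \<open>b = 0\<close>, the relation is trivial.\<close>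

lemma inhom_independent_columns_iff:
  fixes \<Theta> :: "real^'s^'r"
  shows "inhom_independent_columns \<Theta> \<longleftrightarrow>
    (\<forall>n\<in>int_vectors. \<Theta> *v n \<in> int_vectors \<longrightarrow> n = 0)"
proof
  assume ind: "inhom_independent_columns \<Theta>"
  show "\<forall>n\<in>int_vectors. \<Theta> *v n \<in> int_vectors \<longrightarrow> n = 0"
  proof (intro ballI impI)
    fix n :: "real^'s" assume n: "n \<in> int_vectors" "\<Theta> *v n \<in> int_vectors"
    \<comment> \<open>The floor only converts the integer entries to rational numbers.\<close>
    define c :: "'s + 'r \<Rightarrow> rat"
      where "c = case_sum (\<lambda>j. of_int \<lfloor>n $ j\<rfloor>) (\<lambda>i. - of_int \<lfloor>(\<Theta> *v n) $ i\<rfloor>)"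
    have "(\<chi> j. of_rat (c (Inl j))) = n" "(\<chi> i. of_rat (c (Inr i))) = - (\<Theta> *v n)"
      using n by (simp_all add: c_def vec_eq_iff int_vectors_def of_rat_minus)
    then have "\<forall>i. c i = 0"
      using ind sum_columns_and_axes[of c \<Theta>]
      unfolding inhom_independent_columns_def rat_independent_def by simp
    with \<open>(\<chi> j. of_rat (c (Inl j))) = n\<close> show "n = 0"
      by (simp add: vec_eq_iff)
  qed
next
  assume none: "\<forall>n\<in>int_vectors. \<Theta> *v n \<in> int_vectors \<longrightarrow> n = 0"
  show "inhom_independent_columns \<Theta>"
    unfolding inhom_independent_columns_def rat_independent_def
  proof (intro allI impI)
    fix c :: "'s + 'r \<Rightarrow> rat" and i
    assume rel: "(\<Sum>i\<in>UNIV. of_rat (c i) *\<^sub>R case_sum (\<lambda>j. column j \<Theta>) (\<lambda>i. axis i 1) i) = 0"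
    define a :: "real^'s" where "a = (\<chi> j. of_rat (c (Inl j)))"
    define b :: "real^'r" where "b = (\<chi> i. of_rat (c (Inr i)))"
    have ab: "\<Theta> *v a = - b"
      using rel by (simp add: sum_columns_and_axes a_def b_def eq_neg_iff_add_eq_0)
    obtain d :: int where d: "d > 0" "\<And>i. of_int d * c i \<in> \<int>"
      using finite_common_denominator[of UNIV c] by auto
    have int: "of_int d * (of_rat (c i) :: real) \<in> \<int>" for i
    proof -
      obtain k where "of_int d * c i = of_int k" using d(2) Ints_cases by metis
      then have "of_rat (of_int d * c i) = (of_rat (of_int k) :: real)" by simp
      then show ?thesis by (simp add: of_rat_mult)
    qed
    have "of_int d *\<^sub>R a \<in> int_vectors"
      using int by (simp add: int_vectors_def a_def)
    moreover have "\<Theta> *v (of_int d *\<^sub>R a) \<in> int_vectors"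
      using int by (simp add: matrix_vector_mult_scaleR ab int_vectors_def b_def)
    ultimately have "a = 0" using none d(1) by fastforce
    with ab have "b = 0" by simp
    show "c i = 0"
      using \<open>a = 0\<close> \<open>b = 0\<close> by (cases i) (simp_all add: a_def b_def vec_eq_iff)
  qed
qed

section \<open>Kronecker foliations\<close>

theorem theorem11:
  fixes U :: "nat filter" and \<Theta> :: "real^'s^'r"
  assumes "nonprincipal_ultrafilter U"
  shows "Gamma_lattice U \<Theta> \<subseteq> int_lattice \<and>
    top_group_iso
      (additive_group (graph_space \<Theta>) Mod Gamma_lattice U \<Theta>)
      (coset_topology (graph_space \<Theta>) (Gamma_lattice U \<Theta>))
      (leaf_group \<Theta>) (leaf_topology \<Theta>)
      (\<lambda>C. the_elem (torus_proj ` C)) \<and>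
    top_group_isomorphic
      (additive_group (graph_space \<Theta>) Mod Gamma_lattice U \<Theta>)
      (coset_topology (graph_space \<Theta>) (Gamma_lattice U \<Theta>))
      (additive_group UNIV Mod std_kernel U \<Theta>)
      (coset_topology UNIV (std_kernel U \<Theta>)) \<and>
    (has_planar_leaves \<Theta> \<longleftrightarrow> inhom_independent_columns \<Theta>)"
proof (intro conjI)
  have U: "U \<noteq> bot"
    using assms by (simp add: nonprincipal_ultrafilter_def)
  show "Gamma_lattice U \<Theta> \<subseteq> int_lattice"
    by (simp add: Gamma_lattice_eq[OF U])
  show "top_group_iso
      (additive_group (graph_space \<Theta>) Mod Gamma_lattice U \<Theta>)
      (coset_topology (graph_space \<Theta>) (Gamma_lattice U \<Theta>))
      (leaf_group \<Theta>) (leaf_topology \<Theta>)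
      (\<lambda>C. the_elem (torus_proj ` C))"
    by (rule leaf_is_graph_mod_Gamma[OF U])
  show "top_group_isomorphic
      (additive_group (graph_space \<Theta>) Mod Gamma_lattice U \<Theta>)
      (coset_topology (graph_space \<Theta>) (Gamma_lattice U \<Theta>))
      (additive_group UNIV Mod std_kernel U \<Theta>)
      (coset_topology UNIV (std_kernel U \<Theta>))"
    by (rule graph_mod_Gamma_isomorphic[OF U])
  have "std_kernel U \<Theta> = {0} \<longleftrightarrow> inhom_independent_columns \<Theta>"
    using additive_subgroup_std_kernel[OF U, of \<Theta>]
    by (auto simp: inhom_independent_columns_iff std_kernel_eq[OF U] additive_subgroup_iff)
  then show "has_planar_leaves \<Theta> \<longleftrightarrow> inhom_independent_columns \<Theta>"
    by (simp add: has_planar_leaves_iff[OF U])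
qed

end
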